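(* For any graphs $G$ and $H$, the corona product $G\bigcirc H$ satisfies $$\mathrm{tww}(G\bigcirc H)\le\max\{\mathrm{tww}(G)+1,\ \mathrm{tww}(H),\ 2\}.$$
   Context: All graphs are finite and simple (no loops or multiple edges). Twin-width. A trigraph $G$ has a vertex set $V(G)$, a set $E(G)$ of black edges and a set $R(G)$ of red edges, with $E(G)\cap R(G)=\emptyset$; a graph is a trigraph with no red edges. $N_G(v)$ is the set of vertices joined to $v$ by a black or red edge. A $d$-trigraph is a trigraph in which every vertex is incident with at most $d$ red edges. A contraction merges two distinct (not necessarily adjacent) vertices $u,v$ into a new vertex $w$: every vertex other than $u,v$ in $N_G(u)\triangle N_G(v)$ is joined to $w$ by a red edge; every $x\in N_G(u)\cap N_G(v)$ is joined to $w$ by a black edge if $ux,vx\in E(G)$ and by a red edge otherwise; all edges not incident with $u$ or $v$ are unchanged, and $u,v$ and their incident edges are removed. A $d$-sequence of an $n$-vertex graph $G$ is a sequence of $d$-trigraphs $G_n=G,G_{n-1},\dots,G_1=K_1$ with each $G_{i-1}$ obtained from $G_i$ by one contraction. The twin-width $\mathrm{tww}(G)$ is the least $d$ such that $G$ admits a $d$-sequence. Corona product. $G\bigcirc H$ has vertex set $V(G)\times(\{\infty\}\cup V(H))$, where $\infty\notin V(H)$, and $(u,i)(v,j)$ is an edge iff one of the following holds: $uv\in E(G)$ and $i=j=\infty$; or $u=v$ and $ij\in E(H)$; or $u=v$ and exactly one of $i,j$ equals $\infty$. *)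

theory Defs
  imports "Graph_Theory.Graph_Theory"
begin

text \<open>
  Finite simple graphs are the symmetric loop-free digraphs of locale \<open>pair_graph\<close>: an undirected
  edge \<open>uv\<close> is the pair of arcs \<open>(u, v)\<close>, \<open>(v, u)\<close>.  Black and red edges of a trigraph are encoded
  in the same way.
\<close>

record 'a trigraph =
  tverts :: "'a set"
  black :: "'a rel"
  red :: "'a rel"

definition trigraph :: "'a trigraph \<Rightarrow> bool" where
  "trigraph T \<longleftrightarrow>
     pair_graph \<lparr> pverts = tverts T, parcs = black T \<rparr> \<and>
     pair_graph \<lparr> pverts = tverts T, parcs = red T \<rparr> \<and>
     black T \<inter> red T = {}"

definition trigraph_of :: "'a pair_pre_digraph \<Rightarrow> 'a trigraph" where
  "trigraph_of G = \<lparr> tverts = pverts G, black = parcs G, red = {} \<rparr>"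

definition nbhd :: "'a trigraph \<Rightarrow> 'a \<Rightarrow> 'a set" where
  "nbhd T v = {x. (v, x) \<in> black T \<union> red T}"

definition d_trigraph :: "nat \<Rightarrow> 'a trigraph \<Rightarrow> bool" where
  "d_trigraph d T \<longleftrightarrow> trigraph T \<and> (\<forall>v \<in> tverts T. card {x. (v, x) \<in> red T} \<le> d)"

definition contract :: "'a trigraph \<Rightarrow> 'a \<Rightarrow> 'a \<Rightarrow> 'a \<Rightarrow> 'a trigraph" where
  "contract T u v w =
    (let V = tverts T - {u, v};
         B = {x \<in> nbhd T u \<inter> nbhd T v. (u, x) \<in> black T \<and> (v, x) \<in> black T};
         R = (sym_diff (nbhd T u) (nbhd T v) - {u, v}) \<union>
             {x \<in> nbhd T u \<inter> nbhd T v. \<not> ((u, x) \<in> black T \<and> (v, x) \<in> black T)}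
     in \<lparr> tverts = insert w V,
          black = Restr (black T) V \<union> {w} \<times> B \<union> B \<times> {w},
          red = Restr (red T) V \<union> {w} \<times> R \<union> R \<times> {w} \<rparr>)"

text \<open>
  The merged vertex may be any element of the type that is not a remaining vertex.  It may reuse
  the name \<open>u\<close> or \<open>v\<close>, so contractions exist even if the vertices exhaust the type.
\<close>

definition contraction :: "'a trigraph \<Rightarrow> 'a trigraph \<Rightarrow> bool" where
  "contraction T T' \<longleftrightarrow>
     (\<exists>u \<in> tverts T. \<exists>v \<in> tverts T. \<exists>w. u \<noteq> v \<and> w \<notin> tverts T - {u, v} \<and> T' = contract T u v w)"

definition K1 :: "'a \<Rightarrow> 'a trigraph" where
  "K1 x = \<lparr> tverts = {x}, black = {}, red = {} \<rparr>"

definition d_sequence :: "nat \<Rightarrow> 'a pair_pre_digraph \<Rightarrow> (nat \<Rightarrow> 'a trigraph) \<Rightarrow> bool" where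
  "d_sequence d G S \<longleftrightarrow>
    (let n = card (pverts G)
     in 1 \<le> n \<and> S n = trigraph_of G \<and> (\<exists>x. S 1 = K1 x) \<and>
        (\<forall>i \<in> {1..n}. d_trigraph d (S i)) \<and>
        (\<forall>i \<in> {2..n}. contraction (S i) (S (i - 1))))"

text \<open>
  The graph without vertices has no \<open>d\<close>-sequence; its twin-width is \<open>0\<close> by convention.  Every other
  finite simple graph has a \<open>d\<close>-sequence for some \<open>d\<close> (\<open>ex_d_sequence\<close> below), so the \<open>LEAST\<close> is
  meaningful.
\<close>

definition tww :: "'a pair_pre_digraph \<Rightarrow> nat" where
  "tww G = (if pverts G = {} then 0 else (LEAST d. \<exists>S. d_sequence d G S))"

text \<open>In the corona product \<open>None\<close> plays the role of \<open>\<infinity>\<close>.\<close>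

definition corona :: "'a pair_pre_digraph \<Rightarrow> 'b pair_pre_digraph \<Rightarrow> ('a \<times> 'b option) pair_pre_digraph"
  where
  "corona G H =
    (let V = pverts G \<times> insert None (Some ` pverts H)
     in \<lparr> pverts = V,
          parcs = {((u, i), (v, j)) | u i v j. (u, i) \<in> V \<and> (v, j) \<in> V \<and>
            ((u, v) \<in> parcs G \<and> i = None \<and> j = None \<or>
             u = v \<and> (\<exists>a b. i = Some a \<and> j = Some b \<and> (a, b) \<in> parcs H) \<or>
             u = v \<and> (i = None) \<noteq> (j = None))} \<rparr>)"

lemma pair_graph_iff:
  "pair_graph G \<longleftrightarrow> finite (pverts G) \<and> parcs G \<subseteq> pverts G \<times> pverts G \<and>
     sym (parcs G) \<and> irrefl (parcs G)"
proof
  assume "pair_graph G"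
  then interpret pair_graph G .
  show "finite (pverts G) \<and> parcs G \<subseteq> pverts G \<times> pverts G \<and> sym (parcs G) \<and> irrefl (parcs G)"
    using pair_finite_verts pair_sym_arcs pair_no_loops arc_fst_in_verts arc_snd_in_verts
    by (fastforce simp: symmetric_def irrefl_def)
next
  assume A: "finite (pverts G) \<and> parcs G \<subseteq> pverts G \<times> pverts G \<and> sym (parcs G) \<and> irrefl (parcs G)"
  then have "finite (parcs G)"
    by (meson finite_SigmaI finite_subset)
  with A show "pair_graph G"
    by unfold_locales (auto simp: symmetric_def irrefl_def)
qed

lemma pair_graph_corona:
  assumes "pair_graph G" "pair_graph H"
  shows "pair_graph (corona G H)"
proof -
  have 1: "finite (pverts (corona G H))" "parcs (corona G H) \<subseteq> pverts (corona G H) \<times> pverts (corona G H)"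
    using assms by (auto simp: pair_graph_iff corona_def Let_def)
  have 2: "sym (parcs (corona G H))"
    using assms unfolding pair_graph_iff corona_def Let_def
    by (auto intro!: symI dest: symD)
  have 3: "irrefl (parcs (corona G H))"
    using assms unfolding pair_graph_iff corona_def Let_def irrefl_def by auto
  from 1 2 3 show ?thesis by (simp add: pair_graph_iff)
qed

lemma trigraph_of: "pair_graph G \<Longrightarrow> trigraph (trigraph_of G)"
  by (auto simp: trigraph_def trigraph_of_def pair_graph_iff irrefl_def sym_def)

lemma trigraph_contraction:
  assumes T: "trigraph T" and c: "contraction T T'"
  shows "trigraph T'" "card (tverts T) = Suc (card (tverts T'))"
proof -
  from c obtain u v w where uv: "u \<in> tverts T" "v \<in> tverts T" "u \<noteq> v"
    and w: "w \<notin> tverts T - {u, v}" and T': "T' = contract T u v w"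
    unfolding contraction_def by blast
  have fin: "finite (tverts T)" and sub: "black T \<subseteq> tverts T \<times> tverts T" "red T \<subseteq> tverts T \<times> tverts T"
    and sy: "sym (black T)" "sym (red T)" and ir: "irrefl (black T)" "irrefl (red T)"
    and dis: "black T \<inter> red T = {}"
    using T by (auto simp: trigraph_def pair_graph_iff)
  have V': "tverts T' = insert w (tverts T - {u, v})"
    by (simp add: T' contract_def Let_def)
  show "card (tverts T) = Suc (card (tverts T'))"
  proof -
    have "card (tverts T') = Suc (card (tverts T - {u, v}))"
      using w fin V' by simp
    moreover have "card (tverts T - {u, v}) = card (tverts T) - 2"
      using uv fin by (simp add: card_Diff_subset)
    moreover have "card {u, v} \<le> card (tverts T)"
      using uv fin by (intro card_mono) auto
    ultimately show ?thesis using uv by simp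
  qed
  define V where "V = tverts T - {u, v}"
  define B where "B = {x \<in> nbhd T u \<inter> nbhd T v. (u, x) \<in> black T \<and> (v, x) \<in> black T}"
  define R where "R = (sym_diff (nbhd T u) (nbhd T v) - {u, v}) \<union>
             {x \<in> nbhd T u \<inter> nbhd T v. \<not> ((u, x) \<in> black T \<and> (v, x) \<in> black T)}"
  have bl: "black T' = Restr (black T) V \<union> {w} \<times> B \<union> B \<times> {w}"
    and rd: "red T' = Restr (red T) V \<union> {w} \<times> R \<union> R \<times> {w}"
    by (simp_all add: T' contract_def Let_def V_def B_def R_def)
  have BV: "B \<subseteq> V" using sub ir by (auto simp: B_def V_def irrefl_def)
  have RV: "R \<subseteq> V" using sub ir by (auto simp: R_def V_def nbhd_def irrefl_def)
  have BR: "B \<inter> R = {}" by (auto simp: B_def R_def)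
  have wV: "w \<notin> V" using w by (simp add: V_def)
  have VV: "tverts T' = insert w V" using V' by (simp add: V_def)
  have "black T' \<inter> red T' = {}"
    unfolding bl rd using dis BR BV RV wV by blast
  moreover have "sym (black T')" "sym (red T')"
    unfolding bl rd using sy by (auto simp: sym_def)
  moreover have "irrefl (black T')" "irrefl (red T')"
    unfolding bl rd using ir BV RV wV by (auto simp: irrefl_def)
  moreover have "black T' \<subseteq> tverts T' \<times> tverts T'" "red T' \<subseteq> tverts T' \<times> tverts T'"
    unfolding bl rd VV using BV RV by blast+
  moreover have "finite (tverts T')" using fin by (simp add: V')
  ultimately show "trigraph T'" by (simp add: trigraph_def pair_graph_iff)
qed

lemma d_trigraph_card:
  assumes "trigraph T"
  shows "d_trigraph (card (tverts T)) T"
  unfolding d_trigraph_def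
proof (intro conjI ballI assms)
  fix v
  have "finite (tverts T)" "{x. (v, x) \<in> red T} \<subseteq> tverts T"
    using assms by (auto simp: trigraph_def pair_graph_iff)
  then show "card {x. (v, x) \<in> red T} \<le> card (tverts T)" by (rule card_mono)
qed

lemma ex_contraction_chain:
  assumes "trigraph T" "card (tverts T) = n" "1 \<le> n" "n \<le> d"
  shows "\<exists>S. S n = T \<and> (\<exists>x. S 1 = K1 x) \<and> (\<forall>i \<in> {1..n}. d_trigraph d (S i)) \<and>
           (\<forall>i \<in> {2..n}. contraction (S i) (S (i - 1)))"
  using assms
proof (induction n arbitrary: T)
  case 0
  then show ?case by simp
next
  case (Suc n)
  have dT: "d_trigraph d T"
    using d_trigraph_card[OF Suc.prems(1)] Suc.prems(2,4) by (fastforce simp: d_trigraph_def)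
  show ?case
  proof (cases "n = 0")
    case True
    then obtain x where x: "tverts T = {x}"
      using Suc.prems(2) by (auto simp: card_1_singleton_iff)
    have "black T = {}" "red T = {}"
      using Suc.prems(1) x by (auto simp: trigraph_def pair_graph_iff irrefl_def)
    then have "T = K1 x" using x by (simp add: K1_def)
    with True dT show ?thesis by (intro exI[of _ "\<lambda>_. T"]) auto
  next
    case False
    then have "2 \<le> card (tverts T)" using Suc.prems(2) by simp
    then obtain u v where uv: "u \<in> tverts T" "v \<in> tverts T" "u \<noteq> v"
      by (metis (full_types) card_le_Suc0_iff_eq not_less_eq_eq numeral_2_eq_2 card.infinite zero_le)
    then have c: "contraction T (contract T u v u)"
      unfolding contraction_def by blast
    obtain S where S: "S n = contract T u v u" "\<exists>x. S 1 = K1 x"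
      "\<forall>i \<in> {1..n}. d_trigraph d (S i)" "\<forall>i \<in> {2..n}. contraction (S i) (S (i - 1))"
      using Suc.IH[of "contract T u v u"] trigraph_contraction[OF Suc.prems(1) c] Suc.prems False
      by auto
    define S' where "S' = S(Suc n := T)"
    have "S' (Suc n) = T" "\<exists>x. S' 1 = K1 x" using S(2) False by (auto simp: S'_def)
    moreover have "\<forall>i \<in> {1..Suc n}. d_trigraph d (S' i)"
      using S(3) dT by (auto simp: S'_def le_Suc_eq)
    moreover have "\<forall>i \<in> {2..Suc n}. contraction (S' i) (S' (i - 1))"
      using S(1,4) c by (auto simp: S'_def le_Suc_eq)
    ultimately show ?thesis by blast
  qed
qed

lemma ex_d_sequence:
  assumes "pair_graph G" "pverts G \<noteq> {}"
  shows "\<exists>S. d_sequence (card (pverts G)) G S"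
proof -
  have "1 \<le> card (pverts G)"
    using assms by (simp add: pair_graph_iff Suc_le_eq card_gt_0_iff)
  then show ?thesis
    using ex_contraction_chain[OF trigraph_of[OF assms(1)], of "card (pverts G)"]
    by (simp add: d_sequence_def Let_def trigraph_of_def)
qed

end

theory Submission
  imports Defs
begin

text \<open>
  First contract every copy of \<open>H\<close> to a single vertex, one copy at a time: the apex of a copy is joined
  to all its vertices by black edges, so these contractions create no red edges at the apex.  What
  remains is \<open>G\<close> with a pendant vertex at each vertex.  A contraction of \<open>u\<close> and \<open>v\<close> in a sequence for
  \<open>G\<close> is then simulated by first contracting the pendants of \<open>u\<close> and \<open>v\<close>, which yields a vertex of
  red degree at most 2, and then \<open>u\<close> and \<open>v\<close> themselves; pendants add at most 1 to the red degree
  of the vertices of \<open>G\<close>.  If \<open>H\<close> is empty, a sequence for \<open>G\<close> carries over directly.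
\<close>

section \<open>Trigraphs and chains of contractions\<close>

lemma trigraphD:
  assumes "trigraph T"
  shows "finite (tverts T)"
    "(x, y) \<in> black T \<Longrightarrow> x \<in> tverts T \<and> y \<in> tverts T \<and> x \<noteq> y \<and> (x, y) \<notin> red T"
    "(x, y) \<in> red T \<Longrightarrow> x \<in> tverts T \<and> y \<in> tverts T \<and> x \<noteq> y \<and> (x, y) \<notin> black T"
    "(x, y) \<in> black T \<longleftrightarrow> (y, x) \<in> black T"
    "(x, y) \<in> red T \<longleftrightarrow> (y, x) \<in> red T"
  using assms by (auto simp: trigraph_def pair_graph_iff sym_def irrefl_def)

lemma trigraphI:
  assumes "finite (tverts T)"
    "\<And>x y. (x, y) \<in> black T \<Longrightarrow>
      x \<in> tverts T \<and> y \<in> tverts T \<and> x \<noteq> y \<and> (y, x) \<in> black T \<and> (x, y) \<notin> red T"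
    "\<And>x y. (x, y) \<in> red T \<Longrightarrow> x \<in> tverts T \<and> y \<in> tverts T \<and> x \<noteq> y \<and> (y, x) \<in> red T"
  shows "trigraph T"
  using assms unfolding trigraph_def pair_graph_iff sym_def irrefl_def by fastforce

text \<open>Only the target has to be a \<open>d\<close>-trigraph, so that a
  \<open>d\<close>-sequence becomes a path of the reflexive transitive closure and sequences compose
  by transitivity. The bound on the starting trigraph is stated separately where it matters.\<close>

definition contraction_step :: "nat \<Rightarrow> 'a trigraph \<Rightarrow> 'a trigraph \<Rightarrow> bool" where
  "contraction_step d T T' \<longleftrightarrow> contraction T T' \<and> d_trigraph d T'"

lemma d_trigraph_mono: "d_trigraph d T \<Longrightarrow> d \<le> e \<Longrightarrow> d_trigraph e T"
  unfolding d_trigraph_def by fastforce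

lemma contraction_steps_mono:
  assumes "(contraction_step d)\<^sup>*\<^sup>* T T'" "d \<le> e"
  shows "(contraction_step e)\<^sup>*\<^sup>* T T'"
  using assms(1)
  by (rule rtranclp_mono[THEN predicate2D, rotated])
    (use assms(2) in \<open>auto simp: contraction_step_def intro: d_trigraph_mono\<close>)

lemma d_trigraph_steps:
  assumes "(contraction_step d)\<^sup>*\<^sup>* T T'" "d_trigraph d T"
  shows "d_trigraph d T'"
  using assms by induction (auto simp: contraction_step_def)

lemma tverts_K1 [simp]: "tverts (K1 x) = {x}"
  and black_K1 [simp]: "black (K1 x) = {}"
  and red_K1 [simp]: "red (K1 x) = {}"
  by (simp_all add: K1_def)

lemma trigraph_K1: "trigraph (K1 x)"
  by (simp add: trigraph_def K1_def pair_graph_iff sym_def irrefl_def)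

lemma d_trigraph_K1: "d_trigraph d (K1 x)"
  using trigraph_K1 by (simp add: d_trigraph_def K1_def)

lemma trigraph_singleton_eq_K1:
  assumes "trigraph T" "card (tverts T) = 1"
  shows "\<exists>x. T = K1 x"
proof -
  obtain x where "tverts T = {x}"
    using assms(2) by (auto simp: card_1_singleton_iff)
  moreover from this have "black T = {}" "red T = {}"
    using assms(1) by (auto simp: trigraph_def pair_graph_iff irrefl_def)
  ultimately have "T = K1 x" by (simp add: K1_def)
  then show ?thesis ..
qed

lemma steps_of_d_sequence:
  assumes "d_sequence d G S"
  shows "d_trigraph d (trigraph_of G)" "\<exists>x. (contraction_step d)\<^sup>*\<^sup>* (trigraph_of G) (K1 x)"
proof -
  define n where "n = card (pverts G)"
  have n: "1 \<le> n" "S n = trigraph_of G" "\<exists>x. S 1 = K1 x"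
    and d: "\<forall>i \<in> {1..n}. d_trigraph d (S i)"
    and c: "\<forall>i \<in> {2..n}. contraction (S i) (S (i - 1))"
    using assms by (auto simp: d_sequence_def Let_def n_def)
  show "d_trigraph d (trigraph_of G)" using n d by force
  \<comment> \<open>Indices count vertices, so the sequence runs downwards and a larger
    \<open>k\<close> adds a step at the front of the chain. The value \<open>k = 0\<close> only
    starts the induction.\<close>
  have "k \<le> n \<Longrightarrow> 1 \<le> k \<Longrightarrow> (contraction_step d)\<^sup>*\<^sup>* (S k) (S 1)" for k
  proof (induction k)
    case (Suc k)
    show ?case
    proof (cases "k = 0")
      case False
      with Suc.prems have "contraction_step d (S (Suc k)) (S k)"
        using bspec[OF c, of "Suc k"] bspec[OF d, of k] by (simp add: contraction_step_def)
      moreover have "(contraction_step d)\<^sup>*\<^sup>* (S k) (S 1)" using Suc False by simp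
      ultimately show ?thesis by (rule converse_rtranclp_into_rtranclp)
    qed simp
  qed simp
  with n show "\<exists>x. (contraction_step d)\<^sup>*\<^sup>* (trigraph_of G) (K1 x)" by (metis order_refl)
qed

text \<open>Converse of \<open>steps_of_d_sequence\<close>, stated for arbitrary trigraphs because
  the intermediate ones may have red edges and are then not of the form
  \<open>trigraph_of G\<close>. Each contraction removes one vertex, so a trigraph \<open>T\<close>
  put in front of a chain of length \<open>n\<close> takes index \<open>Suc n\<close>.\<close>

lemma sequence_of_steps:
  assumes "(contraction_step d)\<^sup>*\<^sup>* T (K1 x)" "d_trigraph d T"
  shows "1 \<le> card (tverts T) \<and> (\<exists>S. S (card (tverts T)) = T \<and> (\<exists>x. S 1 = K1 x) \<and>
    (\<forall>i \<in> {1..card (tverts T)}. d_trigraph d (S i)) \<and>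
    (\<forall>i \<in> {2..card (tverts T)}. contraction (S i) (S (i - 1))))"
  using assms
proof (induction rule: converse_rtranclp_induct)
  case base
  have "card (tverts (K1 x)) = 1" by (simp add: K1_def)
  then show ?case by (auto intro!: exI[of _ "\<lambda>_. K1 x"] simp: d_trigraph_K1)
next
  case (step T T')
  define n where "n = card (tverts T')"
  have c: "contraction T T'" and dT': "d_trigraph d T'"
    using step.hyps(1) by (auto simp: contraction_step_def)
  have n: "card (tverts T) = Suc n"
    using trigraph_contraction(2)[OF _ c] step.prems by (simp add: d_trigraph_def n_def)
  obtain S where n1: "1 \<le> n" and S: "S n = T'" "\<exists>x. S 1 = K1 x"
    "\<forall>i \<in> {1..n}. d_trigraph d (S i)" "\<forall>i \<in> {2..n}. contraction (S i) (S (i - 1))"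
    using step.IH[OF dT'] by (auto simp: n_def)
  define S' where "S' = S(Suc n := T)"
  have "S' (Suc n) = T" "\<exists>x. S' 1 = K1 x" using S(2) n1 by (auto simp: S'_def)
  moreover have "\<forall>i \<in> {1..Suc n}. d_trigraph d (S' i)"
    using S(3) step.prems by (auto simp: S'_def le_Suc_eq)
  moreover have "\<forall>i \<in> {2..Suc n}. contraction (S' i) (S' (i - 1))"
    using S(1,4) c by (auto simp: S'_def le_Suc_eq)
  ultimately show ?case unfolding n by auto
qed

lemma tww_steps:
  assumes "pair_graph G" "pverts G \<noteq> {}"
  shows "d_trigraph (tww G) (trigraph_of G)"
    "\<exists>x. (contraction_step (tww G))\<^sup>*\<^sup>* (trigraph_of G) (K1 x)"
proof -
  \<comment> \<open>As \<open>G\<close> has a vertex, \<open>tww G\<close> is the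
    \<open>LEAST\<close> of a nonempty set and is attained.\<close>
  have "\<exists>S. d_sequence (tww G) G S"
    using LeastI_ex[of "\<lambda>d. \<exists>S. d_sequence d G S"] ex_d_sequence[OF assms] assms(2)
    by (auto simp: tww_def)
  then show "d_trigraph (tww G) (trigraph_of G)"
    "\<exists>x. (contraction_step (tww G))\<^sup>*\<^sup>* (trigraph_of G) (K1 x)"
    using steps_of_d_sequence by blast+
qed

lemma tww_le_steps:
  assumes "(contraction_step d)\<^sup>*\<^sup>* (trigraph_of G) (K1 x)" "d_trigraph d (trigraph_of G)"
  shows "tww G \<le> d"
proof -
  have "\<exists>S. d_sequence d G S"
    using sequence_of_steps[OF assms] by (simp add: d_sequence_def Let_def trigraph_of_def)
  then show ?thesis by (auto simp: tww_def intro: Least_le)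
qed

section \<open>Edges of a contracted trigraph\<close>

lemma tverts_contract: "tverts (contract T u v w) = insert w (tverts T - {u, v})"
  by (simp add: contract_def Let_def)

lemma black_contract_iff:
  "(x, y) \<in> black (contract T u v w) \<longleftrightarrow>
    x \<in> tverts T - {u, v} \<and> y \<in> tverts T - {u, v} \<and> (x, y) \<in> black T \<or>
    x = w \<and> (u, y) \<in> black T \<and> (v, y) \<in> black T \<or>
    y = w \<and> (u, x) \<in> black T \<and> (v, x) \<in> black T"
  unfolding contract_def Let_def nbhd_def by auto

text \<open>No vertex lies in its own neighbourhood, so \<open>u\<close> and \<open>v\<close> are
  outside \<open>nbhd T u \<inter> nbhd T v\<close>, and the two sets defining the red neighbours of
  \<open>w\<close> fuse into one: all neighbours of \<open>u\<close> or \<open>v\<close> except the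
  common black ones.\<close>

lemma red_contract_iff:
  assumes "trigraph T"
  shows "(x, y) \<in> red (contract T u v w) \<longleftrightarrow>
    x \<in> tverts T - {u, v} \<and> y \<in> tverts T - {u, v} \<and> (x, y) \<in> red T \<or>
    x = w \<and> y \<in> nbhd T u \<union> nbhd T v - {u, v} \<and> \<not> ((u, y) \<in> black T \<and> (v, y) \<in> black T) \<or>
    y = w \<and> x \<in> nbhd T u \<union> nbhd T v - {u, v} \<and> \<not> ((u, x) \<in> black T \<and> (v, x) \<in> black T)"
proof -
  have "u \<notin> nbhd T u" "v \<notin> nbhd T v"
    using trigraphD(2,3)[OF assms] by (auto simp: nbhd_def)
  then have "sym_diff (nbhd T u) (nbhd T v) - {u, v} \<union>
      {x \<in> nbhd T u \<inter> nbhd T v. \<not> ((u, x) \<in> black T \<and> (v, x) \<in> black T)} =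
    {x \<in> nbhd T u \<union> nbhd T v - {u, v}. \<not> ((u, x) \<in> black T \<and> (v, x) \<in> black T)}"
    by (auto simp: nbhd_def)
  then show ?thesis unfolding contract_def Let_def by simp blast
qed

section \<open>Coronas with varying fibres\<close>

text \<open>Black and red edges of a corona have the same shape, so one relation serves both:
  \<open>E\<close> relates the apexes, \<open>D u\<close> the vertices inside the fibre of
  \<open>u\<close>, and \<open>J u\<close> is the part of that fibre joined to its apex.\<close>

definition corona_rel :: "'a rel \<Rightarrow> ('a \<Rightarrow> 'b rel) \<Rightarrow> ('a \<Rightarrow> 'b set) \<Rightarrow> ('a \<times> 'b option) rel" where
  "corona_rel E D J = {((u, i), (v, j)). case (i, j) of
      (None, None) \<Rightarrow> (u, v) \<in> E
    | (Some a, Some b) \<Rightarrow> u = v \<and> (a, b) \<in> D u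
    | (None, Some b) \<Rightarrow> u = v \<and> b \<in> J u
    | (Some a, None) \<Rightarrow> u = v \<and> a \<in> J u}"

lemma corona_rel_simps [simp]:
  "((u, None), (v, None)) \<in> corona_rel E D J \<longleftrightarrow> (u, v) \<in> E"
  "((u, Some a), (v, Some b)) \<in> corona_rel E D J \<longleftrightarrow> u = v \<and> (a, b) \<in> D u"
  "((u, None), (v, Some b)) \<in> corona_rel E D J \<longleftrightarrow> u = v \<and> b \<in> J u"
  "((u, Some a), (v, None)) \<in> corona_rel E D J \<longleftrightarrow> u = v \<and> a \<in> J u"
  by (auto simp: corona_rel_def)

text \<open>
  Each vertex \<open>u\<close> of \<open>T\<close> carries its own fibre \<open>F u\<close>, to which it is joined by red edges if
  \<open>u \<in> P\<close> and by black edges otherwise.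
\<close>

definition corona_trigraph ::
  "'a trigraph \<Rightarrow> ('a \<Rightarrow> 'b trigraph) \<Rightarrow> 'a set \<Rightarrow> ('a \<times> 'b option) trigraph" where
  "corona_trigraph T F P =
    \<lparr> tverts = (SIGMA u : tverts T. insert None (Some ` tverts (F u))),
      black = corona_rel (black T) (\<lambda>u. if u \<in> tverts T then black (F u) else {})
        (\<lambda>u. if u \<in> tverts T - P then tverts (F u) else {}),
      red = corona_rel (red T) (\<lambda>u. if u \<in> tverts T then red (F u) else {})
        (\<lambda>u. if u \<in> tverts T \<inter> P then tverts (F u) else {}) \<rparr>"

lemma corona_trigraph_simps [simp]:
  "(u, None) \<in> tverts (corona_trigraph T F P) \<longleftrightarrow> u \<in> tverts T"
  "(u, Some a) \<in> tverts (corona_trigraph T F P) \<longleftrightarrow> u \<in> tverts T \<and> a \<in> tverts (F u)"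
  "((u, None), (v, None)) \<in> black (corona_trigraph T F P) \<longleftrightarrow> (u, v) \<in> black T"
  "((u, Some a), (v, Some b)) \<in> black (corona_trigraph T F P) \<longleftrightarrow>
     u = v \<and> u \<in> tverts T \<and> (a, b) \<in> black (F u)"
  "((u, None), (v, Some b)) \<in> black (corona_trigraph T F P) \<longleftrightarrow>
     u = v \<and> u \<in> tverts T - P \<and> b \<in> tverts (F u)"
  "((u, Some b), (v, None)) \<in> black (corona_trigraph T F P) \<longleftrightarrow>
     u = v \<and> u \<in> tverts T - P \<and> b \<in> tverts (F u)"
  "((u, None), (v, None)) \<in> red (corona_trigraph T F P) \<longleftrightarrow> (u, v) \<in> red T"
  "((u, Some a), (v, Some b)) \<in> red (corona_trigraph T F P) \<longleftrightarrow>
     u = v \<and> u \<in> tverts T \<and> (a, b) \<in> red (F u)"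
  "((u, None), (v, Some b)) \<in> red (corona_trigraph T F P) \<longleftrightarrow>
     u = v \<and> u \<in> tverts T \<inter> P \<and> b \<in> tverts (F u)"
  "((u, Some b), (v, None)) \<in> red (corona_trigraph T F P) \<longleftrightarrow>
     u = v \<and> u \<in> tverts T \<inter> P \<and> b \<in> tverts (F u)"
  by (auto simp: corona_trigraph_def split: if_splits)

text \<open>The four combinations of constructors are those of \<open>corona_trigraph_simps\<close>,
  so equality of edge sets becomes a matter of simplification.\<close>

lemma option_pair_rel_eqI:
  fixes R S :: "('a \<times> 'b option) rel"
  assumes "\<And>u v. ((u, None), (v, None)) \<in> R \<longleftrightarrow> ((u, None), (v, None)) \<in> S"
    "\<And>u v b. ((u, None), (v, Some b)) \<in> R \<longleftrightarrow> ((u, None), (v, Some b)) \<in> S"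
    "\<And>u v a. ((u, Some a), (v, None)) \<in> R \<longleftrightarrow> ((u, Some a), (v, None)) \<in> S"
    "\<And>u v a b. ((u, Some a), (v, Some b)) \<in> R \<longleftrightarrow> ((u, Some a), (v, Some b)) \<in> S"
  shows "R = S"
proof -
  have "((u, i), (v, j)) \<in> R \<longleftrightarrow> ((u, i), (v, j)) \<in> S" for u v i j
    using assms by (cases i; cases j) auto
  then show ?thesis by auto
qed

lemma option_pair_set_eqI:
  fixes A B :: "('a \<times> 'b option) set"
  assumes "\<And>u. (u, None) \<in> A \<longleftrightarrow> (u, None) \<in> B" "\<And>u b. (u, Some b) \<in> A \<longleftrightarrow> (u, Some b) \<in> B"
  shows "A = B"
proof -
  have "(u, i) \<in> A \<longleftrightarrow> (u, i) \<in> B" for u i using assms by (cases i) auto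
  then show ?thesis by auto
qed

lemma trigraph_corona_trigraph:
  assumes T: "trigraph T" and F: "\<And>u. u \<in> tverts T \<Longrightarrow> trigraph (F u)"
  shows "trigraph (corona_trigraph T F P)"
proof (rule trigraphI)
  show "finite (tverts (corona_trigraph T F P))"
    using trigraphD(1)[OF T] trigraphD(1)[OF F] by (simp add: corona_trigraph_def)
next
  fix x y :: "'a \<times> 'b option"
  obtain u i v j where xy: "x = (u, i)" "y = (v, j)" by (metis surj_pair)
  show "x \<in> tverts (corona_trigraph T F P) \<and> y \<in> tverts (corona_trigraph T F P) \<and> x \<noteq> y \<and>
      (y, x) \<in> black (corona_trigraph T F P) \<and> (x, y) \<notin> red (corona_trigraph T F P)"
    if "(x, y) \<in> black (corona_trigraph T F P)"
    using that by (cases i; cases j) (auto simp: xy trigraphD(4)[OF T] trigraphD(4)[OF F] dest: trigraphD(2)[OF T] trigraphD(2)[OF F])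
  show "x \<in> tverts (corona_trigraph T F P) \<and> y \<in> tverts (corona_trigraph T F P) \<and> x \<noteq> y \<and>
      (y, x) \<in> red (corona_trigraph T F P)"
    if "(x, y) \<in> red (corona_trigraph T F P)"
    using that by (cases i; cases j) (auto simp: xy trigraphD(5)[OF T] trigraphD(5)[OF F] dest: trigraphD(3)[OF T] trigraphD(3)[OF F])
qed

text \<open>Start of the simulation: all edges are black, hence \<open>P\<close> is empty. For arcs
  of \<open>G\<close> and \<open>H\<close> the vertex conditions in \<open>corona\<close> hold by
  \<open>pair_graph\<close>.\<close>

lemma trigraph_of_corona:
  assumes "pair_graph G" "pair_graph H"
  shows "trigraph_of (corona G H) = corona_trigraph (trigraph_of G) (\<lambda>_. trigraph_of H) {}"
proof (rule trigraph.equality)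
  show "black (trigraph_of (corona G H)) = black (corona_trigraph (trigraph_of G) (\<lambda>_. trigraph_of H) {})"
    using assms by (intro option_pair_rel_eqI) (auto simp: trigraph_of_def corona_def Let_def pair_graph_iff)
  show "red (trigraph_of (corona G H)) = red (corona_trigraph (trigraph_of G) (\<lambda>_. trigraph_of H) {})"
    by (intro option_pair_rel_eqI) (auto simp: trigraph_of_def)
qed (auto simp: trigraph_of_def corona_def corona_trigraph_def Let_def)

section \<open>Contractions inside the fibres\<close>

lemma red_corona_trigraph_fibre:
  assumes "u \<in> tverts T"
  shows "card {y. ((u, Some a), y) \<in> red (corona_trigraph T F {})} = card {b. (a, b) \<in> red (F u)}"
proof -
  have "{y. ((u, Some a), y) \<in> red (corona_trigraph T F {})} =
      (\<lambda>b. (u, Some b)) ` {b. (a, b) \<in> red (F u)}"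
    by (rule option_pair_set_eqI) (use assms in auto)
  then show ?thesis by (simp add: card_image inj_on_def)
qed

lemma red_corona_trigraph_base:
  "card {y. ((u, None), y) \<in> red (corona_trigraph T F {})} = card {v. (u, v) \<in> red T}"
proof -
  have "{y. ((u, None), y) \<in> red (corona_trigraph T F {})} = (\<lambda>v. (v, None)) ` {v. (u, v) \<in> red T}"
    by (rule option_pair_set_eqI) auto
  then show ?thesis by (simp add: card_image inj_on_def)
qed

text \<open>With \<open>P\<close> empty, all edges between apexes and fibres are black, so each
  vertex keeps the red degree that it has in \<open>T\<close> or in its fibre.\<close>

lemma d_trigraph_corona_trigraph:
  assumes "d_trigraph d T" "\<And>u. u \<in> tverts T \<Longrightarrow> d_trigraph d (F u)"
  shows "d_trigraph d (corona_trigraph T F {})"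
  unfolding d_trigraph_def
proof (intro conjI ballI)
  show "trigraph (corona_trigraph T F {})"
    using assms by (intro trigraph_corona_trigraph) (auto simp: d_trigraph_def)
  fix x assume x: "x \<in> tverts (corona_trigraph T F {})"
  obtain u i where ui: "x = (u, i)" by (metis surj_pair)
  show "card {y. (x, y) \<in> red (corona_trigraph T F {})} \<le> d"
    using x assms by (cases i)
      (auto simp: ui d_trigraph_def red_corona_trigraph_base red_corona_trigraph_fibre)
qed

text \<open>Outside its fibre, a fibre vertex is adjacent only to its apex, by a black edge. Merging
  two vertices of one fibre leaves a black edge to the apex and otherwise acts on that fibre
  alone.\<close>

lemma contract_fibre:
  assumes T: "trigraph T" and F: "\<And>u. u \<in> tverts T \<Longrightarrow> trigraph (F u)"
    and u: "u \<in> tverts T" and ab: "a \<in> tverts (F u)" "b \<in> tverts (F u)" "a \<noteq> b"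
    and c: "c \<notin> tverts (F u) - {a, b}"
  shows "contract (corona_trigraph T F {}) (u, Some a) (u, Some b) (u, Some c) =
    corona_trigraph T (F(u := contract (F u) a b c)) {}" (is "?L = ?R")
proof (rule trigraph.equality)
  note tri = trigraph_corona_trigraph[OF T F]
  note D = trigraphD(2,3)[OF F] trigraphD(2,3)[OF T]
  show "tverts ?L = tverts ?R"
    by (rule option_pair_set_eqI) (use u in \<open>auto simp: tverts_contract\<close>)
  show "black ?L = black ?R"
    using u ab c
    by (intro option_pair_rel_eqI)
      (auto simp: black_contract_iff tverts_contract dest: D)
  show "red ?L = red ?R"
    using u ab c
    by (intro option_pair_rel_eqI)
      (auto simp: red_contract_iff[OF tri] red_contract_iff[OF F] tverts_contract nbhd_def dest: D)
qed simp

lemma contraction_corona_fibre: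
  assumes T: "trigraph T" and F: "\<And>u. u \<in> tverts T \<Longrightarrow> trigraph (F u)"
    and u: "u \<in> tverts T" and c: "contraction (F u) F'"
  shows "contraction (corona_trigraph T F {}) (corona_trigraph T (F(u := F')) {})"
proof -
  obtain a b c where *: "a \<in> tverts (F u)" "b \<in> tverts (F u)" "a \<noteq> b"
    "c \<notin> tverts (F u) - {a, b}" "F' = contract (F u) a b c"
    using c unfolding contraction_def by blast
  have "corona_trigraph T (F(u := F')) {} =
      contract (corona_trigraph T F {}) (u, Some a) (u, Some b) (u, Some c)"
    unfolding *(5) using contract_fibre[of T F, OF T _ u *(1-4)] F by simp
  then show ?thesis unfolding contraction_def
    by (intro bexI[of _ "(u, Some a)"] bexI[of _ "(u, Some b)"] exI[of _ "(u, Some c)"])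
      (use *(1-4) u in auto)
qed

lemma steps_corona_fibre:
  assumes T: "d_trigraph d T" and F: "\<And>u. u \<in> tverts T \<Longrightarrow> d_trigraph d (F u)"
    and u: "u \<in> tverts T" and steps: "(contraction_step d)\<^sup>*\<^sup>* (F u) F'"
  shows "(contraction_step d)\<^sup>*\<^sup>* (corona_trigraph T F {}) (corona_trigraph T (F(u := F')) {})"
  using steps
proof (induction rule: rtranclp_induct)
  case (step F1 F2)
  have 1: "d_trigraph d F1" "d_trigraph d F2" "contraction F1 F2"
    using d_trigraph_steps[OF step.hyps(1)] F[OF u] step.hyps(2) by (auto simp: contraction_step_def)
  have "contraction (corona_trigraph T (F(u := F1)) {}) (corona_trigraph T ((F(u := F1))(u := F2)) {})"
    by (rule contraction_corona_fibre) (use 1 T F u in \<open>auto simp: d_trigraph_def\<close>)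
  moreover have "d_trigraph d (corona_trigraph T (F(u := F2)) {})"
    using T F 1 by (intro d_trigraph_corona_trigraph) auto
  ultimately have "contraction_step d (corona_trigraph T (F(u := F1)) {}) (corona_trigraph T (F(u := F2)) {})"
    by (simp add: contraction_step_def)
  with step.IH show ?case by (rule rtranclp.rtrancl_into_rtrancl)
qed simp

lemma steps_corona_fibres:
  assumes T: "d_trigraph d T" and F0: "d_trigraph d F0"
    and steps: "(contraction_step d)\<^sup>*\<^sup>* F0 F'"
  shows "(contraction_step d)\<^sup>*\<^sup>* (corona_trigraph T (\<lambda>_. F0) {}) (corona_trigraph T (\<lambda>_. F') {})"
proof -
  have F': "d_trigraph d F'" using d_trigraph_steps[OF steps F0] .
  \<comment> \<open>\<open>A\<close> collects the vertices whose fibres have already been contracted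
    to \<open>F'\<close>.\<close>
  have "finite A \<Longrightarrow> A \<subseteq> tverts T \<Longrightarrow> (contraction_step d)\<^sup>*\<^sup>* (corona_trigraph T (\<lambda>_. F0) {})
      (corona_trigraph T (\<lambda>u. if u \<in> A then F' else F0) {})" for A
  proof (induction A rule: finite_induct)
    case (insert u A)
    \<comment> \<open>As \<open>u\<close> is not in \<open>A\<close>, its fibre is still
      \<open>F0\<close>.\<close>
    have "(contraction_step d)\<^sup>*\<^sup>* (corona_trigraph T (\<lambda>u. if u \<in> A then F' else F0) {})
      (corona_trigraph T ((\<lambda>u. if u \<in> A then F' else F0)(u := F')) {})"
      by (rule steps_corona_fibre) (use insert F0 F' T steps in auto)
    moreover have "(\<lambda>u. if u \<in> A then F' else F0)(u := F') =
        (\<lambda>v. if v \<in> insert u A then F' else F0)" by auto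
    ultimately show ?case using insert by (metis (no_types, lifting) insert_subset rtranclp_trans)
  qed simp
  from this[of "tverts T"] have "(contraction_step d)\<^sup>*\<^sup>* (corona_trigraph T (\<lambda>_. F0) {})
      (corona_trigraph T (\<lambda>u. if u \<in> tverts T then F' else F0) {})"
    using T by (simp add: d_trigraph_def trigraphD(1))
  \<comment> \<open>Fibres over points outside \<open>tverts T\<close> do not enter the corona, so
    both functions give the same trigraph.\<close>
  moreover have "corona_trigraph T (\<lambda>u. if u \<in> tverts T then F' else F0) {} =
      corona_trigraph T (\<lambda>_. F') {}" (is "?L = ?R")
  proof (rule trigraph.equality)
    show "tverts ?L = tverts ?R" by (rule option_pair_set_eqI) auto
    show "black ?L = black ?R" "red ?L = red ?R" by (rule option_pair_rel_eqI; auto)+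
  qed simp
  ultimately show ?thesis by simp
qed

section \<open>Simulating a sequence for the base graph in the presence of pendants\<close>

text \<open>Degree count shared by the coronas with pendants and by the intermediate trigraph in
  which two apexes have a common pendant. An apex has at most \<open>d\<close> red neighbours among
  the apexes, plus the pendant \<open>p u\<close>; a pendant has at most the two red neighbours
  \<open>q\<close> and \<open>r\<close>, which may coincide.\<close>

lemma d_trigraph_pendantsI:
  fixes X :: "('a \<times> 'b option) trigraph"
  assumes X: "trigraph X" and T: "d_trigraph d T"
    and verts: "\<And>u. (u, None) \<in> tverts X \<Longrightarrow> u \<in> tverts T"
    and base: "\<And>u v. ((u, None), (v, None)) \<in> red X \<Longrightarrow> (u, v) \<in> red T"
    and pendant: "\<And>u v b. ((u, None), (v, Some b)) \<in> red X \<Longrightarrow> (v, Some b) = p u"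
    and leaf: "\<And>u b. \<exists>q r. \<forall>z. ((u, Some b), z) \<in> red X \<longrightarrow> z \<in> {q, r}"
  shows "d_trigraph (max (d + 1) 2) X"
  unfolding d_trigraph_def
proof (intro conjI ballI X)
  fix y assume y: "y \<in> tverts X"
  obtain u i where ui: "y = (u, i)" by (metis surj_pair)
  show "card {z. (y, z) \<in> red X} \<le> max (d + 1) 2"
  proof (cases i)
    case None
    let ?N = "{v. (u, v) \<in> red T}"
    have "(v, j) \<in> insert (p u) ((\<lambda>v. (v, None)) ` ?N)" if "((u, None), (v, j)) \<in> red X" for v j
      using that base pendant by (cases j) auto
    then have sub: "{z. (y, z) \<in> red X} \<subseteq> insert (p u) ((\<lambda>v. (v, None)) ` ?N)"
      by (auto simp: ui None)
    have "?N \<subseteq> tverts T" "finite (tverts T)"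
      using T trigraphD(1,3)[of T] by (auto simp: d_trigraph_def)
    then have fin: "finite ?N" by (rule finite_subset)
    \<comment> \<open>The inserted pendant accounts for the \<open>+ 1\<close> in the bound.\<close>
    have "card {z. (y, z) \<in> red X} \<le> card (insert (p u) ((\<lambda>v. (v, None)) ` ?N))"
      using sub fin by (intro card_mono) auto
    also have "\<dots> \<le> Suc (card ((\<lambda>v. (v, None :: 'b option)) ` ?N))"
      using fin by (simp add: card_insert_if)
    also have "\<dots> \<le> Suc (card ?N)" using fin by (simp add: card_image_le)
    also have "\<dots> \<le> d + 1" using T verts y by (auto simp: d_trigraph_def ui None)
    finally show ?thesis by simp
  next
    case (Some b)
    obtain q r where "\<forall>z. ((u, Some b), z) \<in> red X \<longrightarrow> z \<in> {q, r}"
      using leaf[of u b] by (elim exE)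
    then have "{z. (y, z) \<in> red X} \<subseteq> {q, r}" by (auto simp: ui Some)
    then have "card {z. (y, z) \<in> red X} \<le> card {q, r}" by (intro card_mono) auto
    also have "\<dots> \<le> 2" by (simp add: card_insert_if)
    finally show ?thesis by simp
  qed
qed

lemma d_trigraph_corona_pendants:
  assumes "d_trigraph d T"
  shows "d_trigraph (max (d + 1) 2) (corona_trigraph T (\<lambda>_. K1 x) P)"
proof (rule d_trigraph_pendantsI[OF _ assms, where p = "\<lambda>u. (u, Some x)"])
  show "trigraph (corona_trigraph T (\<lambda>_. K1 x) P)"
    using assms by (intro trigraph_corona_trigraph trigraph_K1) (simp add: d_trigraph_def)
  have "(v, j) = (u, None)" if "((u, Some b), (v, j)) \<in> red (corona_trigraph T (\<lambda>_. K1 x) P)" for u v b j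
    using that by (cases j) auto
  then show "\<exists>q r. \<forall>z. ((u, Some b), z) \<in> red (corona_trigraph T (\<lambda>_. K1 x) P) \<longrightarrow> z \<in> {q, r}" for u b
    by (metis insertI1 surj_pair)
qed auto

text \<open>The order of the two contractions matters: if the apexes \<open>u\<close> and
  \<open>v\<close> were merged first, the new apex would for a moment have two red pendants, and its
  red degree could reach \<open>d + 2\<close>. Pendant edges change colour along the way, so
  \<open>P'\<close> is left existential.\<close>

lemma steps_corona_pendants:
  assumes T: "d_trigraph d T" and step: "contraction_step d T T'"
  shows "\<exists>P'. (contraction_step (max (d + 1) 2))\<^sup>*\<^sup>*
    (corona_trigraph T (\<lambda>_. K1 x) P) (corona_trigraph T' (\<lambda>_. K1 x) P')"
proof -
  obtain u v w where uv: "u \<in> tverts T" "v \<in> tverts T" "u \<noteq> v"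
    and w: "w \<notin> tverts T - {u, v}" and T': "T' = contract T u v w"
    using step unfolding contraction_step_def contraction_def by blast
  have tT: "trigraph T" using T by (simp add: d_trigraph_def)
  define C where "C = corona_trigraph T (\<lambda>_. K1 x) P"
  define M where "M = contract C (u, Some x) (v, Some x) (w, Some x)"
  \<comment> \<open>The pendant edge of the merged vertex is red whatever the colours were before;
    \<open>w\<close> may reuse the name \<open>u\<close> or \<open>v\<close>.\<close>
  define P' where "P' = insert w (P - {u, v})"
  define N where "N = corona_trigraph T' (\<lambda>_. K1 x) P'"
  have tC: "trigraph C" unfolding C_def by (intro trigraph_corona_trigraph tT trigraph_K1)
  have CM: "contraction C M" unfolding contraction_def
    by (intro bexI[of _ "(u, Some x)"] bexI[of _ "(v, Some x)"] exI[of _ "(w, Some x)"])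
      (use uv w in \<open>auto simp: C_def M_def\<close>)
  then have tM: "trigraph M" by (rule trigraph_contraction(1)[OF tC])
  note D = trigraphD(2,3)[OF tT]
  note C_def [simp]
  \<comment> \<open>The pendants of \<open>u\<close> and \<open>v\<close> have no common neighbour,
    so the merged pendant \<open>(w, Some x)\<close> has exactly two edges, both red, to the apexes
    \<open>u\<close> and \<open>v\<close>. Edges between apexes are still those of
    \<open>T\<close>.\<close>
  have redM:
    "((y, None), (z, None)) \<in> red M \<longleftrightarrow> (y, z) \<in> red T"
    "((y, Some a), (z, Some b)) \<in> red M \<longleftrightarrow> False"
    "((y, None), (z, Some b)) \<in> red M \<longleftrightarrow> b = x \<and>
      (y = z \<and> y \<in> tverts T \<inter> P - {u, v} \<or> y \<in> {u, v} \<and> z = w)"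
    "((z, Some b), (y, None)) \<in> red M \<longleftrightarrow> b = x \<and>
      (y = z \<and> y \<in> tverts T \<inter> P - {u, v} \<or> y \<in> {u, v} \<and> z = w)" for y z a b
    unfolding M_def red_contract_iff[OF tC] using uv w by (auto simp: nbhd_def dest: D)
  have blackM:
    "((y, None), (z, None)) \<in> black M \<longleftrightarrow> (y, z) \<in> black T"
    "((y, Some a), (z, Some b)) \<in> black M \<longleftrightarrow> False"
    "((y, None), (z, Some b)) \<in> black M \<longleftrightarrow> b = x \<and> y = z \<and> y \<in> tverts T - P - {u, v}"
    "((z, Some b), (y, None)) \<in> black M \<longleftrightarrow> b = x \<and> y = z \<and> y \<in> tverts T - P - {u, v}"
    for y z a b
    unfolding M_def black_contract_iff using uv w by (auto dest: D)
  have vertsM: "(y, None) \<in> tverts M \<longleftrightarrow> y \<in> tverts T"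
    "(y, Some b) \<in> tverts M \<longleftrightarrow> b = x \<and> y \<in> insert w (tverts T - {u, v})" for y b
    unfolding M_def tverts_contract using w by auto
  have dM: "d_trigraph (max (d + 1) 2) M"
  \<comment> \<open>The apexes \<open>u\<close> and \<open>v\<close> share the pendant
    \<open>(w, Some x)\<close>; every other apex keeps its own.\<close>
  proof (rule d_trigraph_pendantsI[OF tM T, where p = "\<lambda>y. (if y \<in> {u, v} then w else y, Some x)"])
    \<comment> \<open>Only the shared pendant can have two red neighbours.\<close>
    have "(z, j) \<in> (if y = w then {(u, None), (v, None)} else {(y, None)})"
      if "((y, Some b), (z, j)) \<in> red M" for y z b j
      using that w by (cases j) (auto simp: redM split: if_splits)
    then show "\<exists>q r. \<forall>z. ((y, Some b), z) \<in> red M \<longrightarrow> z \<in> {q, r}" for y b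
      by (cases "y = w") fastforce+
  qed (auto simp: redM vertsM)
  \<comment> \<open>The shared pendant is a common neighbour of \<open>u\<close> and
    \<open>v\<close> through red edges, so a single red edge joins it to the new apex. Among the
    apexes the contraction is that of \<open>T\<close>.\<close>
  have "N = contract M (u, None) (v, None) (w, None)"
  proof (rule trigraph.equality)
    show "tverts N = tverts (contract M (u, None) (v, None) (w, None))"
      by (rule option_pair_set_eqI) (auto simp: N_def T' tverts_contract vertsM)
    show "black N = black (contract M (u, None) (v, None) (w, None))"
      using uv w by (intro option_pair_rel_eqI)
        (auto simp: N_def P'_def T' tverts_contract black_contract_iff vertsM blackM)
    show "red N = red (contract M (u, None) (v, None) (w, None))"
      using uv w by (intro option_pair_rel_eqI)
        (auto simp: N_def P'_def T' tverts_contract red_contract_iff[OF tM] red_contract_iff[OF tT]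
          nbhd_def vertsM blackM redM dest: D)
  qed simp
  then have MN: "contraction M N" unfolding contraction_def
    by (intro bexI[of _ "(u, None)"] bexI[of _ "(v, None)"] exI[of _ "(w, None)"])
      (use uv w in \<open>auto simp: vertsM\<close>)
  have dN: "d_trigraph (max (d + 1) 2) N"
    unfolding N_def using step by (intro d_trigraph_corona_pendants) (simp add: contraction_step_def)
  have "contraction_step (max (d + 1) 2) C M" "contraction_step (max (d + 1) 2) M N"
    using CM dM MN dN by (auto simp: contraction_step_def)
  then have "(contraction_step (max (d + 1) 2))\<^sup>*\<^sup>* C N" by (meson converse_rtranclp_into_rtranclp rtranclp.rtrancl_refl)
  then show ?thesis by (auto simp: N_def)
qed

text \<open>\<open>P\<close> is arbitrary in the induction because each simulated contraction may
  change it. When the base has shrunk to \<open>K1 g\<close>, an apex with its pendant remains,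
  which takes one more contraction.\<close>

lemma steps_corona_pendants_K1:
  assumes T: "d_trigraph d T" and steps: "(contraction_step d)\<^sup>*\<^sup>* T (K1 g)"
  shows "\<exists>y. (contraction_step (max (d + 1) 2))\<^sup>*\<^sup>* (corona_trigraph T (\<lambda>_. K1 x) P) (K1 y)"
  using steps T
proof (induction arbitrary: P rule: converse_rtranclp_induct)
  case base
  define C where "C = corona_trigraph (K1 g) (\<lambda>_. K1 x) P"
  define C' where "C' = contract C (g, None) (g, Some x) (g, None)"
  have tC: "trigraph C" unfolding C_def by (intro trigraph_corona_trigraph trigraph_K1)
  have c: "contraction C C'" unfolding contraction_def
    by (intro bexI[of _ "(g, None)"] bexI[of _ "(g, Some x)"] exI[of _ "(g, None)"])
      (auto simp: C_def C'_def)
  have "tverts C' = {(g, None)}"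
    unfolding C'_def tverts_contract by (rule option_pair_set_eqI) (auto simp: C_def)
  then obtain y where "C' = K1 y"
    using trigraph_singleton_eq_K1 trigraph_contraction(1)[OF tC c] by fastforce
  with c have "contraction_step (max (d + 1) 2) C (K1 y)"
    by (simp add: contraction_step_def d_trigraph_K1)
  then show ?case unfolding C_def by blast
next
  case (step T T')
  obtain P' where "(contraction_step (max (d + 1) 2))\<^sup>*\<^sup>*
    (corona_trigraph T (\<lambda>_. K1 x) P) (corona_trigraph T' (\<lambda>_. K1 x) P')"
    using steps_corona_pendants[OF step.prems step.hyps(1), of x P] by (elim exE)
  moreover have "d_trigraph d T'" using step.hyps(1) by (simp add: contraction_step_def)
  ultimately show ?case using step.IH by (meson rtranclp_trans)
qed

section \<open>Empty fibres\<close>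

text \<open>Without fibre vertices the corona is a copy of \<open>T\<close> on the vertices
  \<open>(u, None)\<close>, so a contraction carries over literally.\<close>

lemma contraction_corona_empty:
  assumes T: "trigraph T" and F0: "trigraph F0" "tverts F0 = {}" and c: "contraction T T'"
  shows "contraction (corona_trigraph T (\<lambda>_. F0) {}) (corona_trigraph T' (\<lambda>_. F0) {})"
proof -
  obtain u v w where uv: "u \<in> tverts T" "v \<in> tverts T" "u \<noteq> v"
    and w: "w \<notin> tverts T - {u, v}" and T': "T' = contract T u v w"
    using c unfolding contraction_def by blast
  define C where "C = corona_trigraph T (\<lambda>_. F0) {}"
  have tC: "trigraph C" unfolding C_def by (intro trigraph_corona_trigraph T F0)
  have [simp]: "black F0 = {}" "red F0 = {}" using trigraphD(2,3)[OF F0(1)] F0(2) by auto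
  have "corona_trigraph T' (\<lambda>_. F0) {} = contract C (u, None) (v, None) (w, None)" (is "?L = ?R")
  proof (rule trigraph.equality)
    show "tverts ?L = tverts ?R"
      by (rule option_pair_set_eqI) (auto simp: C_def T' tverts_contract F0)
    show "black ?L = black ?R"
      by (rule option_pair_rel_eqI) (auto simp: C_def T' black_contract_iff F0)
    show "red ?L = red ?R"
      by (rule option_pair_rel_eqI)
        (auto simp: C_def T' red_contract_iff[OF tC[unfolded C_def]] red_contract_iff[OF T] F0(2) nbhd_def)
  qed simp
  then show ?thesis unfolding contraction_def C_def
    by (intro bexI[of _ "(u, None)"] bexI[of _ "(v, None)"] exI[of _ "(w, None)"])
      (use uv w in auto)
qed

lemma steps_corona_empty:
  assumes T: "d_trigraph d T" and steps: "(contraction_step d)\<^sup>*\<^sup>* T T'"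
    and F0: "\<And>d. d_trigraph d F0" "tverts F0 = {}"
  shows "(contraction_step d)\<^sup>*\<^sup>* (corona_trigraph T (\<lambda>_. F0) {}) (corona_trigraph T' (\<lambda>_. F0) {})"
  using steps
proof (induction rule: rtranclp_induct)
  case (step T1 T2)
  have d: "d_trigraph d T1" "d_trigraph d T2" "contraction T1 T2"
    using d_trigraph_steps[OF step.hyps(1) T] step.hyps(2) by (auto simp: contraction_step_def)
  have "contraction_step d (corona_trigraph T1 (\<lambda>_. F0) {}) (corona_trigraph T2 (\<lambda>_. F0) {})"
    unfolding contraction_step_def
    using contraction_corona_empty[OF _ _ F0(2) d(3)] d_trigraph_corona_trigraph[OF d(2) F0(1)]
      d(1) F0(1) by (auto simp: d_trigraph_def)
  with step.IH show ?case by (rule rtranclp.rtrancl_into_rtrancl)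
qed simp

section \<open>The bound for the corona product\<close>

theorem theorem3p14:
  fixes G :: "'a pair_pre_digraph" and H :: "'b pair_pre_digraph"
  assumes "pair_graph G" and "pair_graph H"
  shows "tww (corona G H) \<le> Max {tww G + 1, tww H, 2}"
proof (cases "pverts G = {}")
  \<comment> \<open>The corona has no vertices either, and its twin-width is \<open>0\<close> by
    convention.\<close>
  case True
  then have "tww (corona G H) = 0" by (simp add: tww_def corona_def Let_def)
  then show ?thesis by simp
next
  case False
  define e where "e = Max {tww G + 1, tww H, 2}"
  have e: "tww G \<le> e" "tww H \<le> e" "max (tww G + 1) 2 \<le> e" by (auto simp: e_def)
  define C where "C = corona_trigraph (trigraph_of G) (\<lambda>_. trigraph_of H) {}"
  obtain g where dG: "d_trigraph (tww G) (trigraph_of G)"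
    and G: "(contraction_step (tww G))\<^sup>*\<^sup>* (trigraph_of G) (K1 g)"
    using tww_steps[OF assms(1) False] by blast
  have "\<exists>y. (contraction_step e)\<^sup>*\<^sup>* C (K1 y)"
  \<comment> \<open>An empty \<open>H\<close> has no sequence ending in \<open>K1\<close>, so its
    fibres cannot be reduced to pendants.\<close>
  proof (cases "pverts H = {}")
    case True
    have H: "d_trigraph d (trigraph_of H)" "tverts (trigraph_of H) = {}" for d
      using True trigraph_of[OF assms(2)] by (auto simp: d_trigraph_def trigraph_of_def)
    let ?K = "corona_trigraph (K1 g) (\<lambda>_. trigraph_of H) {}"
    have "tverts ?K = {(g, None)}"
      by (rule option_pair_set_eqI) (auto simp: H)
    moreover have "trigraph ?K"
      by (intro trigraph_corona_trigraph trigraph_K1 trigraph_of assms)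
    ultimately obtain y where "?K = K1 y" using trigraph_singleton_eq_K1 by fastforce
    \<comment> \<open>No pendants arise here, so the bound \<open>tww G\<close> is kept until the
      last step.\<close>
    with steps_corona_empty[OF dG G H] have "(contraction_step (tww G))\<^sup>*\<^sup>* C (K1 y)"
      by (simp add: C_def)
    then show ?thesis using contraction_steps_mono[OF _ e(1)] by (intro exI)
  next
    case False
    obtain h where dH: "d_trigraph (tww H) (trigraph_of H)"
      and H: "(contraction_step (tww H))\<^sup>*\<^sup>* (trigraph_of H) (K1 h)"
      using tww_steps[OF assms(2) False] by blast
    \<comment> \<open>The sequence for \<open>H\<close> is run in every fibre; \<open>e\<close>
      bounds the red degrees in the base and in the fibres.\<close>
    have "(contraction_step e)\<^sup>*\<^sup>* C (corona_trigraph (trigraph_of G) (\<lambda>_. K1 h) {})"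
      unfolding C_def using dG dH H e
      by (intro steps_corona_fibres) (auto intro: d_trigraph_mono contraction_steps_mono)
    moreover obtain y where "(contraction_step (max (tww G + 1) 2))\<^sup>*\<^sup>*
        (corona_trigraph (trigraph_of G) (\<lambda>_. K1 h) {}) (K1 y)"
      using steps_corona_pendants_K1[OF dG G, of h "{}"] by (elim exE)
    then have "(contraction_step e)\<^sup>*\<^sup>* (corona_trigraph (trigraph_of G) (\<lambda>_. K1 h) {}) (K1 y)"
      using e(3) by (rule contraction_steps_mono)
    ultimately show ?thesis by (meson rtranclp_trans)
  qed
  \<comment> \<open>The chain bounds only the trigraphs after \<open>C\<close>; \<open>C\<close>
    itself has no red edges and meets every bound.\<close>
  moreover have "d_trigraph 0 (trigraph_of G)" "d_trigraph 0 (trigraph_of H)"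
    using trigraph_of assms by (auto simp: d_trigraph_def trigraph_of_def)
  then have "d_trigraph e C"
    unfolding C_def by (intro d_trigraph_mono[OF d_trigraph_corona_trigraph le0])
  ultimately show ?thesis
    unfolding e_def[symmetric] C_def trigraph_of_corona[OF assms, symmetric]
    by (elim exE) (rule tww_le_steps)
qed

end
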